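(* Let $\{(G_n,r_n),g_n^{n+1}\}_{n\in\mathbb{N}}$ be a cell structure and let $\{(H_n,s_n),h_n^{n+1}\}_{n\in\mathbb{N}}$ be a complete cell structure. If $f\colon\bigcup_{i\in\mathbb{N}}G_i\to\bigcup_{i\in\mathbb{N}}H_i$ is a cell map, then $f$ induces a weak g-cell map $\overline{f}\colon G_\infty\to H_\infty$ given by $\overline{f}(\overline{x})=\overline{y}$, where $\overline{y}\in H_\infty$ is a thread to which the sequence $\{f(x_n)\}_{n\in\mathbb{N}}$ converges. That is, for every $\overline{x}=(x_n)_{n\in\mathbb{N}}\in G_\infty$ the sequence $\{f(x_n)\}_{n\in\mathbb{N}}$ converges to some thread of $H_\infty$, and a function $\overline{f}\colon G_\infty\to H_\infty$ assigning to each $\overline{x}$ such a thread is a weak g-cell map.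
   Context: $\mathbb{N}=\{1,2,3,\dots\}$. A cellular graph is a pair $(G,r)$ with $G$ a non-empty topological space and $r\subset G\times G$ a reflexive and symmetric relation. An inverse sequence of cellular graphs $\{(G_n,r_n),g_n^{n+1}\}_{n\in\mathbb{N}}$ consists of cellular graphs $(G_n,r_n)$ and continuous bonding maps $g_n^{n+1}\colon G_{n+1}\to G_n$ with $(g_n^{n+1}(x),g_n^{n+1}(y))\in r_n$ whenever $(x,y)\in r_{n+1}$; $g_n^m\colon G_m\to G_n$ ($n\le m$) denotes the composite, with $g_n^n$ the identity. Its inverse limit $G_\infty=\{\overline{x}=(x_n)_{n}\in\prod_n G_n : g_i^j(x_j)=x_i \text{ for all } j\ge i\}$ has the subspace topology of the product; its elements are called threads. The natural relation on $G_\infty$ is $r=\{(\overline{x},\overline{y}) : (x_n,y_n)\in r_n \ \forall n\in\mathbb{N}\}$; analogously $H_\infty$ and $s$ are obtained from $\{(H_n,s_n),h_n^{n+1}\}$. For $u\in G$, $B(u,r)=\{v\in G:(u,v)\in r\}$ and $B(u,2r)=\{a\in G: \exists b\in B(u,r),\ a\in B(b,r)\}$. Unions $\bigcup_n G_n$ are disjoint unions; elements of $G_n$ are called cells of degree $n$, written $\deg(u)=n$ for $u\in G_n$. Cell structure: an inverse sequence of cellular graphs with every $G_n$ discrete such that for each $\overline{x}\in G_\infty$ and each $i\in\mathbb{N}$ there is $j\ge i$ with $g_i^j(B(x_j,2r_j))\subset B(x_i,r_i)$, and for each $\overline{x}\in G_\infty$ and each $i\in\mathbb{N}$ there is $j\ge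 i$ with $g_i^j(B(x_j,r_j))$ finite. Cells $a\in G_m$ and $b\in G_n$ are close if $(g_k^m(a),g_k^n(b))\in r_k$ with $k=\min\{m,n\}$. A sequence $\{u_j\}$ of cells is Cauchy if $\deg(u_j)\to\infty$ and there is $N$ such that $u_m,u_n$ are close for all $m,n>N$. A sequence $\{u_j\}$ of cells converges to a thread $\overline{x}$ if $\deg(u_j)\to\infty$ and there is $N$ such that $x_i$ and $u_j$ are close for all $i,j>N$. A cell structure is complete if every Cauchy sequence of cells converges to some thread. A cell map $f\colon\bigcup_i G_i\to\bigcup_i H_i$ between cell structures is a function taking close cells to close cells and Cauchy sequences to Cauchy sequences. A weak g-cell map is a function $\varphi\colon G_\infty\to H_\infty$ such that $(\overline{x},\overline{y})\in r$ implies $(\varphi(\overline{x}),\varphi(\overline{y}))\in s$. *)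

theory Defs
  imports "HOL-Analysis.Analysis"
begin

text \<open>
  All indices range over \<open>{1..}\<close>, the natural numbers being \<open>1, 2, 3, \<dots>\<close>; the values at
  index \<open>0\<close> of families and sequences are never constrained.  The spaces \<open>G n\<close> of one inverse
  sequence are topologies with carriers in a common type, which is no restriction, since any
  sequence of sets embeds in its disjoint union.  The carriers may overlap: disjointness is
  only imposed in the set of cells, where each cell is tagged with its degree.
\<close>

definition cellular_graph :: "'a topology \<Rightarrow> ('a \<times> 'a) set \<Rightarrow> bool" where
  "cellular_graph X r \<longleftrightarrow>
     topspace X \<noteq> {} \<and> r \<subseteq> topspace X \<times> topspace X \<and> refl_on (topspace X) r \<and> sym r"

definition graph_ball :: "('a \<times> 'a) set \<Rightarrow> 'a \<Rightarrow> 'a set" where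
  "graph_ball r u = {v. (u, v) \<in> r}"

definition graph_ball2 :: "('a \<times> 'a) set \<Rightarrow> 'a \<Rightarrow> 'a set" where
  "graph_ball2 r u = {a. \<exists>b\<in>graph_ball r u. a \<in> graph_ball r b}"

locale inverse_sequence =
  fixes G :: "nat \<Rightarrow> 'a topology"
    and r :: "nat \<Rightarrow> ('a \<times> 'a) set"
    and g :: "nat \<Rightarrow> 'a \<Rightarrow> 'a"  \<comment> \<open>\<open>g n\<close> is the bonding map from \<open>G (Suc n)\<close> to \<open>G n\<close>\<close>
  assumes cellular_graph: "n \<ge> 1 \<Longrightarrow> cellular_graph (G n) (r n)"
    and continuous_bonding: "n \<ge> 1 \<Longrightarrow> continuous_map (G (Suc n)) (G n) (g n)"
    and bonding_rel: "n \<ge> 1 \<Longrightarrow> (x, y) \<in> r (Suc n) \<Longrightarrow> (g n x, g n y) \<in> r n"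

text \<open>The composite from \<open>G m\<close> to \<open>G n\<close> is \<open>bond g n m\<close>; it is only meaningful for \<open>n \<le> m\<close>.\<close>

primrec bond :: "(nat \<Rightarrow> 'a \<Rightarrow> 'a) \<Rightarrow> nat \<Rightarrow> nat \<Rightarrow> 'a \<Rightarrow> 'a" where
  "bond g n 0 = id"
| "bond g n (Suc m) = (if n \<le> m then bond g n m \<circ> g m else id)"

text \<open>Points of the product topology are extensional, so a thread is \<open>undefined\<close> at index \<open>0\<close>.\<close>

definition inverse_limit :: "(nat \<Rightarrow> 'a topology) \<Rightarrow> (nat \<Rightarrow> 'a \<Rightarrow> 'a) \<Rightarrow> (nat \<Rightarrow> 'a) topology" where
  "inverse_limit G g =
     subtopology (product_topology G {1..}) {x. \<forall>i\<ge>1. \<forall>j\<ge>i. bond g i j (x j) = x i}"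

abbreviation threads :: "(nat \<Rightarrow> 'a topology) \<Rightarrow> (nat \<Rightarrow> 'a \<Rightarrow> 'a) \<Rightarrow> (nat \<Rightarrow> 'a) set" where
  "threads G g \<equiv> topspace (inverse_limit G g)"

definition natural_relation ::
    "(nat \<Rightarrow> 'a topology) \<Rightarrow> (nat \<Rightarrow> ('a \<times> 'a) set) \<Rightarrow> (nat \<Rightarrow> 'a \<Rightarrow> 'a)
      \<Rightarrow> ((nat \<Rightarrow> 'a) \<times> (nat \<Rightarrow> 'a)) set" where
  "natural_relation G r g =
     {(x, y). x \<in> threads G g \<and> y \<in> threads G g \<and> (\<forall>n\<ge>1. (x n, y n) \<in> r n)}"

locale cell_structure = inverse_sequence +
  assumes discrete: "n \<ge> 1 \<Longrightarrow> G n = discrete_topology (topspace (G n))"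
    and ball2_contraction: "x \<in> threads G g \<Longrightarrow> i \<ge> 1 \<Longrightarrow>
      \<exists>j\<ge>i. bond g i j ` graph_ball2 (r j) (x j) \<subseteq> graph_ball (r i) (x i)"
    and finite_ball_image: "x \<in> threads G g \<Longrightarrow> i \<ge> 1 \<Longrightarrow>
      \<exists>j\<ge>i. finite (bond g i j ` graph_ball (r j) (x j))"

text \<open>The disjoint union of the \<open>G n\<close>: the cell \<open>u\<close> of degree \<open>n\<close> is the pair \<open>(n, u)\<close>.\<close>

definition cells :: "(nat \<Rightarrow> 'a topology) \<Rightarrow> (nat \<times> 'a) set" where
  "cells G = (SIGMA n:{1..}. topspace (G n))"

abbreviation deg :: "nat \<times> 'a \<Rightarrow> nat" where
  "deg \<equiv> fst"

definition close_cells ::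
    "(nat \<Rightarrow> ('a \<times> 'a) set) \<Rightarrow> (nat \<Rightarrow> 'a \<Rightarrow> 'a) \<Rightarrow> nat \<times> 'a \<Rightarrow> nat \<times> 'a \<Rightarrow> bool" where
  "close_cells r g a b \<longleftrightarrow>
     (let k = min (deg a) (deg b)
      in (bond g k (deg a) (snd a), bond g k (deg b) (snd b)) \<in> r k)"

definition Cauchy_cells ::
    "(nat \<Rightarrow> 'a topology) \<Rightarrow> (nat \<Rightarrow> ('a \<times> 'a) set) \<Rightarrow> (nat \<Rightarrow> 'a \<Rightarrow> 'a)
      \<Rightarrow> (nat \<Rightarrow> nat \<times> 'a) \<Rightarrow> bool" where
  "Cauchy_cells G r g u \<longleftrightarrow>
     (\<forall>j\<ge>1. u j \<in> cells G) \<and>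
     filterlim (\<lambda>j. deg (u j)) at_top sequentially \<and>
     (\<exists>N\<ge>1. \<forall>m>N. \<forall>n>N. close_cells r g (u m) (u n))"

definition cells_converge_to ::
    "(nat \<Rightarrow> 'a topology) \<Rightarrow> (nat \<Rightarrow> ('a \<times> 'a) set) \<Rightarrow> (nat \<Rightarrow> 'a \<Rightarrow> 'a)
      \<Rightarrow> (nat \<Rightarrow> nat \<times> 'a) \<Rightarrow> (nat \<Rightarrow> 'a) \<Rightarrow> bool" where
  "cells_converge_to G r g u x \<longleftrightarrow>
     (\<forall>j\<ge>1. u j \<in> cells G) \<and> x \<in> threads G g \<and>
     filterlim (\<lambda>j. deg (u j)) at_top sequentially \<and>
     (\<exists>N\<ge>1. \<forall>i>N. \<forall>j>N. close_cells r g (i, x i) (u j))"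

locale complete_cell_structure = cell_structure +
  assumes complete: "Cauchy_cells G r g u \<Longrightarrow> \<exists>x\<in>threads G g. cells_converge_to G r g u x"

definition cell_map ::
    "(nat \<Rightarrow> 'a topology) \<Rightarrow> (nat \<Rightarrow> ('a \<times> 'a) set) \<Rightarrow> (nat \<Rightarrow> 'a \<Rightarrow> 'a)
      \<Rightarrow> (nat \<Rightarrow> 'b topology) \<Rightarrow> (nat \<Rightarrow> ('b \<times> 'b) set) \<Rightarrow> (nat \<Rightarrow> 'b \<Rightarrow> 'b)
      \<Rightarrow> (nat \<times> 'a \<Rightarrow> nat \<times> 'b) \<Rightarrow> bool" where
  "cell_map G r g H s h f \<longleftrightarrow>
     f \<in> cells G \<rightarrow> cells H \<and>
     (\<forall>a\<in>cells G. \<forall>b\<in>cells G. close_cells r g a b \<longrightarrow> close_cells s h (f a) (f b)) \<and>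
     (\<forall>u. Cauchy_cells G r g u \<longrightarrow> Cauchy_cells H s h (\<lambda>j. f (u j)))"

definition weak_g_cell_map ::
    "(nat \<Rightarrow> 'a topology) \<Rightarrow> (nat \<Rightarrow> ('a \<times> 'a) set) \<Rightarrow> (nat \<Rightarrow> 'a \<Rightarrow> 'a)
      \<Rightarrow> (nat \<Rightarrow> 'b topology) \<Rightarrow> (nat \<Rightarrow> ('b \<times> 'b) set) \<Rightarrow> (nat \<Rightarrow> 'b \<Rightarrow> 'b)
      \<Rightarrow> ((nat \<Rightarrow> 'a) \<Rightarrow> (nat \<Rightarrow> 'b)) \<Rightarrow> bool" where
  "weak_g_cell_map G r g H s h \<phi> \<longleftrightarrow>
     \<phi> \<in> threads G g \<rightarrow> threads H h \<and>
     (\<forall>x y. (x, y) \<in> natural_relation G r g \<longrightarrow> (\<phi> x, \<phi> y) \<in> natural_relation H s h)"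

end

theory Submission
  imports Defs
begin

text \<open>
  A thread, read as a sequence of cells, is Cauchy: any two of its entries project to the same
  cell at the lower of their degrees.  Its image under a cell map is therefore Cauchy, and
  completeness of the target supplies a limit.

  The substance is that limits preserve the natural relation.  Let \<open>u\<close> and \<open>v\<close> be sequences of
  cells with limits \<open>p\<close> and \<open>q\<close>, such that \<open>u m\<close> and \<open>v m\<close> are close for large \<open>m\<close>.  Projecting
  far-out cells of these sequences to a level \<open>j\<close> yields a chain \<open>p j, u m, v m, q j\<close> of three
  related steps, whereas the axiom of a cell structure contracts only chains of two steps, starting
  at an entry of a thread.  It is applied twice along \<open>p\<close>: at a high level it merges the first two
  steps into one, leaving a chain of two steps at a middle level, and these merge into a single
  step at a lower level.  Since bonding maps preserve the relations, a
  relation between \<open>p\<close> and \<open>q\<close> at arbitrarily high levels gives one at all levels; this is the lemma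
  \<open>close_cells_limits_related\<close>.  Related threads have close entries at each level, and cell maps
  preserve closeness, so the lemma applies to their images.
\<close>

lemma bond_self [simp]: "bond g n n = id"
  by (cases n) auto

lemma bond_bond:
  "i \<le> k \<Longrightarrow> k \<le> m \<Longrightarrow> bond g i k (bond g k m a) = bond g i m a"
proof (induction m arbitrary: a)
  case (Suc m)
  then show ?case by (cases "k = Suc m") auto
qed simp

lemma thread_bond:
  "x \<in> threads G g \<Longrightarrow> 1 \<le> i \<Longrightarrow> i \<le> j \<Longrightarrow> bond g i j (x j) = x i"
  by (auto simp: inverse_limit_def)

lemma thread_in_space: "x \<in> threads G g \<Longrightarrow> 1 \<le> i \<Longrightarrow> x i \<in> topspace (G i)"
  by (auto simp: inverse_limit_def PiE_iff)

context inverse_sequence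
begin

lemma rel_refl: "1 \<le> n \<Longrightarrow> a \<in> topspace (G n) \<Longrightarrow> (a, a) \<in> r n"
  using cellular_graph[of n] by (auto simp: cellular_graph_def refl_on_def)

lemma rel_sym: "1 \<le> n \<Longrightarrow> (a, b) \<in> r n \<Longrightarrow> (b, a) \<in> r n"
  using cellular_graph[of n] by (auto simp: cellular_graph_def dest: symD)

lemma bond_rel:
  "1 \<le> k \<Longrightarrow> k \<le> m \<Longrightarrow> (a, b) \<in> r m \<Longrightarrow> (bond g k m a, bond g k m b) \<in> r k"
proof (induction m arbitrary: a b)
  case (Suc m)
  show ?case
  proof (cases "k = Suc m")
    case False
    with Suc.prems have "(g m a, g m b) \<in> r m"
      by (intro bonding_rel) auto
    with Suc False show ?thesis by auto
  qed (use Suc.prems in auto)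
qed simp

text \<open>
  Closeness is tested at the smaller of the two degrees only; it persists at all lower levels, so
  that cells of different degrees can be compared at a common one.
\<close>

lemma close_cells_project:
  assumes "close_cells r g a b" "1 \<le> k" "k \<le> deg a" "k \<le> deg b"
  shows "(bond g k (deg a) (snd a), bond g k (deg b) (snd b)) \<in> r k"
proof -
  let ?l = "min (deg a) (deg b)"
  have "(bond g ?l (deg a) (snd a), bond g ?l (deg b) (snd b)) \<in> r ?l"
    using assms(1) by (simp add: close_cells_def Let_def)
  from bond_rel[OF \<open>1 \<le> k\<close> _ this] show ?thesis
    using assms by (simp add: bond_bond)
qed

lemma Cauchy_cells_thread:
  assumes x: "x \<in> threads G g"
  shows "Cauchy_cells G r g (\<lambda>n. (n, x n))"
proof -
  have "close_cells r g (m, x m) (n, x n)" if "m > 1" "n > 1" for m n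
  proof -
    have "1 \<le> min m n" using that by simp
    then have "bond g (min m n) m (x m) = x (min m n)"
      "bond g (min m n) n (x n) = x (min m n)" "(x (min m n), x (min m n)) \<in> r (min m n)"
      by (simp_all add: thread_bond[OF x] thread_in_space[OF x] rel_refl)
    then show ?thesis by (simp add: close_cells_def Let_def)
  qed
  moreover have "(j, x j) \<in> cells G" if "j \<ge> 1" for j
    using thread_in_space[OF x that] that by (simp add: cells_def)
  ultimately show ?thesis
    unfolding Cauchy_cells_def by (auto simp: filterlim_ident)
qed

end

context cell_structure
begin

lemma ball2_contractionE:
  assumes "x \<in> threads G g" "1 \<le> i"
  obtains j where "i \<le> j"
    and "\<And>b c. (x j, b) \<in> r j \<Longrightarrow> (b, c) \<in> r j \<Longrightarrow> (x i, bond g i j c) \<in> r i"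
  using ball2_contraction[OF assms] by (auto simp: graph_ball_def graph_ball2_def)

text \<open>
  The case \<open>u = v\<close> says that limits are unique up to the natural relation; there a chain of two
  steps, contracted once, suffices.  The extra step from \<open>u m\<close> to \<open>v m\<close> costs a second contraction.
\<close>

lemma close_cells_limits_related:
  assumes u: "cells_converge_to G r g u p"
    and v: "cells_converge_to G r g v q"
    and close: "eventually (\<lambda>m. close_cells r g (u m) (v m)) sequentially"
  shows "(p, q) \<in> natural_relation G r g"
proof -
  have p: "p \<in> threads G g" and q: "q \<in> threads G g"
    and deg: "filterlim (\<lambda>m. deg (u m)) at_top sequentially"
      "filterlim (\<lambda>m. deg (v m)) at_top sequentially"
    using u v by (auto simp: cells_converge_to_def)
  from u obtain M where M: "\<And>i j. M < i \<Longrightarrow> M < j \<Longrightarrow> close_cells r g (i, p i) (u j)"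
    unfolding cells_converge_to_def by blast
  from v obtain N where N: "\<And>i j. N < i \<Longrightarrow> N < j \<Longrightarrow> close_cells r g (i, q i) (v j)"
    unfolding cells_converge_to_def by blast
  have "(p n, q n) \<in> r n" if "1 \<le> n" for n
  proof -
    \<comment> \<open>Convergence gives closeness only for entries of the limit beyond its threshold, so the
      contractions are made to end beyond both thresholds; bonding maps then descend to \<open>n\<close>.\<close>
    define i where "i = Max {n, Suc M, Suc N}"
    have i: "n \<le> i" "M < i" "N < i" "1 \<le> i" using that by (auto simp: i_def)
    obtain j where j: "i \<le> j"
      "\<And>b c. (p j, b) \<in> r j \<Longrightarrow> (b, c) \<in> r j \<Longrightarrow> (p i, bond g i j c) \<in> r i"
      using ball2_contractionE[OF p \<open>1 \<le> i\<close>] by metis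
    have "1 \<le> j" using i j by simp
    obtain k where k: "j \<le> k"
      "\<And>b c. (p k, b) \<in> r k \<Longrightarrow> (b, c) \<in> r k \<Longrightarrow> (p j, bond g j k c) \<in> r j"
      using ball2_contractionE[OF p \<open>1 \<le> j\<close>] by metis
    \<comment> \<open>Cells of degree at least \<open>k\<close> have projections to level \<open>k\<close>, where the chain of three
      steps is formed.\<close>
    have "eventually (\<lambda>m. k \<le> deg (u m) \<and> k \<le> deg (v m) \<and> close_cells r g (u m) (v m)
        \<and> M < m \<and> N < m) sequentially"
      using deg close unfolding filterlim_at_top
      by (intro eventually_conj eventually_gt_at_top) simp_all
    then obtain m where m: "k \<le> deg (u m)" "k \<le> deg (v m)" "close_cells r g (u m) (v m)"
      "M < m" "N < m"
      using eventually_happens'[OF sequentially_bot] by blast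
    define a where "a = bond g k (deg (u m)) (snd (u m))"
    define b where "b l = bond g l (deg (v m)) (snd (v m))" for l
    have "(p k, a) \<in> r k"
      using close_cells_project[OF M, of k m k] i j k m by (simp add: a_def)
    moreover have "(a, b k) \<in> r k"
      using close_cells_project[OF m(3), of k] i j k m by (simp add: a_def b_def)
    ultimately have "(p j, bond g j k (b k)) \<in> r j" by (rule k(2))
    then have "(p j, b j) \<in> r j"
      using j k m by (simp add: b_def bond_bond)
    moreover have "(b j, q j) \<in> r j"
      using close_cells_project[OF N, of j m j] i j k m
      by (intro rel_sym[OF \<open>1 \<le> j\<close>, of "q j"]) (simp add: b_def)
    ultimately have "(p i, bond g i j (q j)) \<in> r i" by (rule j(2))
    then have "(p i, q i) \<in> r i"
      using thread_bond[OF q] i j by simp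
    from bond_rel[OF that \<open>n \<le> i\<close> this] show ?thesis
      using thread_bond[OF p that \<open>n \<le> i\<close>] thread_bond[OF q that \<open>n \<le> i\<close>] by simp
  qed
  with p q show ?thesis by (simp add: natural_relation_def)
qed

end

theorem proposition2p2:
  fixes G :: "nat \<Rightarrow> 'a topology" and r :: "nat \<Rightarrow> ('a \<times> 'a) set" and g :: "nat \<Rightarrow> 'a \<Rightarrow> 'a"
    and H :: "nat \<Rightarrow> 'b topology" and s :: "nat \<Rightarrow> ('b \<times> 'b) set" and h :: "nat \<Rightarrow> 'b \<Rightarrow> 'b"
    and f :: "nat \<times> 'a \<Rightarrow> nat \<times> 'b"
  assumes "cell_structure G r g"
    and "complete_cell_structure H s h"
    and "cell_map G r g H s h f"
  shows "(\<forall>x\<in>threads G g. \<exists>y\<in>threads H h. cells_converge_to H s h (\<lambda>n. f (n, x n)) y) \<and>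
    (\<forall>fbar. fbar \<in> threads G g \<rightarrow> threads H h \<and>
        (\<forall>x\<in>threads G g. cells_converge_to H s h (\<lambda>n. f (n, x n)) (fbar x))
      \<longrightarrow> weak_g_cell_map G r g H s h fbar)"
proof -
  interpret G: cell_structure G r g by (fact assms(1))
  interpret H: complete_cell_structure H s h by (fact assms(2))
  have f_close: "close_cells s h (f a) (f b)"
    if "a \<in> cells G" "b \<in> cells G" "close_cells r g a b" for a b
    using assms(3) that by (auto simp: cell_map_def)
  have f_Cauchy: "Cauchy_cells H s h (\<lambda>j. f (u j))" if "Cauchy_cells G r g u" for u
    using assms(3) that by (auto simp: cell_map_def)
  have limit: "\<exists>y\<in>threads H h. cells_converge_to H s h (\<lambda>n. f (n, x n)) y"
    if "x \<in> threads G g" for x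
    by (intro H.complete f_Cauchy G.Cauchy_cells_thread that)
  have related: "(fbar x, fbar y) \<in> natural_relation H s h"
    if fbar: "\<forall>x\<in>threads G g. cells_converge_to H s h (\<lambda>n. f (n, x n)) (fbar x)"
      and xy: "(x, y) \<in> natural_relation G r g" for fbar x y
  proof -
    have x: "x \<in> threads G g" and y: "y \<in> threads G g"
      and rel: "\<And>n. 1 \<le> n \<Longrightarrow> (x n, y n) \<in> r n"
      using xy by (auto simp: natural_relation_def)
    have "close_cells s h (f (n, x n)) (f (n, y n))" if "1 \<le> n" for n
      using that x y rel[OF that]
      by (intro f_close)
        (simp_all add: cells_def close_cells_def thread_in_space[OF x] thread_in_space[OF y])
    then have "eventually (\<lambda>n. close_cells s h (f (n, x n)) (f (n, y n))) sequentially"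
      by (rule eventually_sequentiallyI)
    with fbar x y show ?thesis
      by (intro H.close_cells_limits_related) auto
  qed
  show ?thesis
    using limit related by (auto simp: weak_g_cell_map_def)
qed

end
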